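(* Let $\lambda\in(0,1)$. Then for every complex number $s$ with $0<\operatorname{Re}(s)<\frac{1-\lambda}{\lambda}$ we have $$\Gamma_{\lambda}(s+1)=\frac{s}{(1-\lambda)^{s+1}}\,\Gamma_{\frac{\lambda}{1-\lambda}}(s).$$
   Context: For real $\lambda\in(0,\infty)$ and complex $s$ with $0<\operatorname{Re}(s)<\frac1\lambda$, the degenerate gamma function is defined by $$\Gamma_{\lambda}(s)=\int_0^{\infty}(1+\lambda t)^{-\frac1\lambda}\,t^{s-1}\,dt .$$ Powers of positive real numbers with complex exponents are $x^{z}=e^{z\log x}$ with the real logarithm. *)

theory Defs
  imports "HOL-Analysis.Analysis"
begin

text \<open>
  The integral is absolutely convergent for \<open>0 < l\<close> and \<open>0 < Re s < 1 / l\<close>, where the function is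
  meant to be used; outside this range the value is whatever the total Lebesgue integral returns.
  On positive reals the complex \<open>powr\<close> is \<open>exp (z * ln x)\<close> with the real logarithm.
\<close>
definition degenerate_Gamma :: "real \<Rightarrow> complex \<Rightarrow> complex" where
  "degenerate_Gamma l s =
     (LINT t:{0<..}|lborel.
        complex_of_real ((1 + l * t) powr (- 1 / l)) * complex_of_real t powr (s - 1))"

end

theory Submission
  imports Defs
begin

text \<open>
  Write \<open>I(l, p, z)\<close> for the integral of \<open>(1 + l t)\<^sup>-\<^sup>p t\<^sup>z\<^sup>-\<^sup>1\<close> over the positive reals, so
  that the degenerate gamma function is the case \<open>p = 1/l\<close>.  Separating the exponent \<open>p\<close> from the
  scale \<open>l\<close> splits the recurrence into two independent moves.

  Integration by parts (\<open>gkernel_integral_by_parts\<close>) lowers \<open>p\<close> and \<open>z\<close> together: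
  \<open>l p I(l, p + 1, z + 1) = z I(l, p, z)\<close>.  Starting from \<open>p + 1 = 1/l\<close> the new exponent is
  \<open>p = (1 - l)/l\<close>, the reciprocal of \<open>l/(1 - l)\<close>; this is where the new parameter comes
  from.  The scale is still \<open>l\<close>, however, and the substitution \<open>t \<mapsto> (1 - l) t\<close>
  (\<open>gkernel_integral_scale\<close>) turns \<open>l/(1 - l)\<close> into \<open>l\<close> at the cost of a factor \<open>(1 - l)\<^sup>s\<close>.
  Together with the \<open>l p = 1 - l\<close> from the first move this gives \<open>(1 - l)\<^sup>s\<^sup>+\<^sup>1\<close>.

  Integration by parts rests on absolute convergence.  Near \<open>0\<close> the kernel is comparable
  to \<open>t\<^sup>z\<^sup>-\<^sup>1\<close> and near infinity to \<open>t\<^sup>z\<^sup>-\<^sup>1\<^sup>-\<^sup>p\<close>, so the integrals converge absolutely for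
  \<open>0 < Re z < p\<close>, and in the same range the boundary terms vanish.
\<close>

definition gkernel :: "real \<Rightarrow> real \<Rightarrow> complex \<Rightarrow> real \<Rightarrow> complex" where
  "gkernel l p z t = complex_of_real ((1 + l * t) powr (- p)) * complex_of_real t powr (z - 1)"

lemma degenerate_Gamma_eq:
  "degenerate_Gamma l s = (LINT t:{0<..}|lborel. gkernel l (1 / l) s t)"
  by (simp add: degenerate_Gamma_def gkernel_def)

lemma norm_gkernel:
  assumes "0 < t"
  shows "norm (gkernel l p z t) = (1 + l * t) powr (- p) * t powr (Re z - 1)"
  using assms by (simp add: gkernel_def norm_mult norm_powr_real_powr)

text \<open>
  Dropping the \<open>1\<close> in \<open>1 + l t\<close> gives a pure power of \<open>t\<close>, sharp at infinity; it controls both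
  the tail of the integral and the boundary term there.
\<close>
lemma norm_gkernel_le_powr:
  assumes "0 < l" and "0 \<le> p" and "0 < t"
  shows "norm (gkernel l p z t) \<le> l powr (- p) * t powr (Re z - 1 - p)"
proof -
  have "(1 + l * t) powr (- p) \<le> (l * t) powr (- p)"
    using assms by (intro powr_mono2') auto
  then have "norm (gkernel l p z t) \<le> (l * t) powr (- p) * t powr (Re z - 1)"
    using assms by (simp add: norm_gkernel mult_right_mono)
  also have "\<dots> = l powr (- p) * (t powr (- p) * t powr (Re z - 1))"
    using assms by (simp add: powr_mult)
  also have "t powr (- p) * t powr (Re z - 1) = t powr (Re z - 1 - p)"
    by (simp add: powr_add [symmetric] algebra_simps)
  finally show ?thesis .
qed

lemma isCont_gkernel:
  assumes "0 < l" and "0 < t"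
  shows "isCont (gkernel l p z) t"
proof -
  have "1 + l * t > 0" using assms by (simp add: add_pos_pos)
  then show ?thesis
    unfolding gkernel_def using assms by (intro continuous_intros) (auto simp: complex_nonpos_Reals_iff)
qed

lemma borel_measurable_indicator_gkernel:
  assumes "0 < l" and "A \<in> sets borel" and "A \<subseteq> {0<..}"
  shows "(\<lambda>t. indicat_real A t *\<^sub>R gkernel l p z t) \<in> borel_measurable borel"
  using assms
  by (intro borel_measurable_continuous_on_indicator continuous_at_imp_continuous_on ballI isCont_gkernel)
     auto

text \<open>
  Integrals of powers are known in the Henstock--Kurzweil sense; nonnegativity makes them absolute,
  hence integrable for the completed measure, and Borel measurability then brings the conclusion
  down to the Borel measure.
\<close>
lemma set_integrable_lborel_powr_dominated:
  fixes f :: "real \<Rightarrow> complex"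
  assumes "(\<lambda>t. t powr q) integrable_on A"
    and [measurable]: "A \<in> sets borel"
    and "(\<lambda>t. indicat_real A t *\<^sub>R f t) \<in> borel_measurable borel"
    and "\<And>t. t \<in> A \<Longrightarrow> norm (f t) \<le> C * t powr q"
  shows "set_integrable lborel A f"
proof -
  have "set_integrable lebesgue A (\<lambda>t. t powr q)"
    by (rule nonnegative_absolutely_integrable_1) (use assms in auto)
  then have *: "set_integrable lborel A (\<lambda>t. t powr q)"
    unfolding set_integrable_def by (subst (asm) integrable_completion) auto
  show ?thesis
  proof (rule set_integrable_bound)
    show "set_integrable lborel A (\<lambda>t. C * t powr q)"
      using * by simp
    show "set_borel_measurable lborel A f"
      using assms by (simp add: set_borel_measurable_def)
    show "AE t in lborel. t \<in> A \<longrightarrow> norm (f t) \<le> norm (C * t powr q)"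
      using assms(4) by (intro AE_I2) force
  qed
qed

lemma set_integrable_gkernel:
  assumes "0 < l" and "0 < Re z" and "Re z < p"
  shows "set_integrable lborel {0<..} (gkernel l p z)"
proof -
  have "set_integrable lborel ({0<..1} \<union> {1..}) (gkernel l p z)"
  proof (rule set_integrable_Un)
    show "set_integrable lborel {0<..1} (gkernel l p z)"
    proof (rule set_integrable_lborel_powr_dominated)
      show "(\<lambda>t::real. t powr (Re z - 1)) integrable_on {0<..1}"
        using assms by (intro integrable_on_powr_from_0') auto
      show "norm (gkernel l p z t) \<le> 1 * t powr (Re z - 1)" if "t \<in> {0<..1}" for t
      proof -
        have "(1 + l * t) powr (- p) \<le> 1 powr (- p)"
          using assms that by (intro powr_mono2') auto
        then show ?thesis
          using that by (simp add: norm_gkernel mult_left_le_one_le)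
      qed
    qed (use assms in \<open>auto intro: borel_measurable_indicator_gkernel\<close>)
  next
    show "set_integrable lborel {1..} (gkernel l p z)"
    proof (rule set_integrable_lborel_powr_dominated)
      show "(\<lambda>t. t powr (Re z - 1 - p)) integrable_on {1::real..}"
        using has_integral_powr_to_inf[of "Re z - 1 - p" 1] assms
        by (auto simp: integrable_on_def)
      show "norm (gkernel l p z t) \<le> l powr (- p) * t powr (Re z - 1 - p)" if "t \<in> {1..}" for t
        using assms that by (intro norm_gkernel_le_powr) auto
    qed (use assms in \<open>auto intro: borel_measurable_indicator_gkernel\<close>)
  qed auto
  moreover have "{0<..1} \<union> {1..} = {0::real<..}" by auto
  ultimately show ?thesis by simp
qed

text \<open>
  The product rule, with the derivatives of the two factors read as kernels again: they sit at
  \<open>(p, z)\<close> and at \<open>(p + 1, z + 1)\<close>, the two sides of the recurrence.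
\<close>
lemma gkernel_has_vector_derivative:
  assumes "0 < l" and "0 < t"
  shows "(gkernel l p (z + 1) has_vector_derivative
            z * gkernel l p z t - of_real (l * p) * gkernel l (p + 1) (z + 1) t) (at t)"
proof -
  have pos: "1 + l * t > 0" using assms by (simp add: add_pos_pos)
  have "((\<lambda>t. (1 + l * t) powr (- p)) has_real_derivative - p * (1 + l * t) powr (- p - 1) * l) (at t)"
    using pos by (auto intro!: derivative_eq_intros)
  then have 1: "((\<lambda>t. complex_of_real ((1 + l * t) powr (- p))) has_vector_derivative
        of_real (- p * (1 + l * t) powr (- p - 1) * l)) (at t)"
    by (intro has_vector_derivative_of_real) (simp add: has_real_derivative_iff_has_vector_derivative)
  have 2: "((\<lambda>t. complex_of_real t powr z) has_vector_derivative
              z * complex_of_real t powr (z - 1)) (at t)"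
    using has_vector_derivative_real_field [OF has_field_derivative_powr [of "complex_of_real t" z]]
      assms by (simp add: complex_nonpos_Reals_iff)
  have "((\<lambda>t. complex_of_real ((1 + l * t) powr (- p)) * complex_of_real t powr z)
          has_vector_derivative
            z * gkernel l p z t - of_real (l * p) * gkernel l (p + 1) (z + 1) t) (at t)"
    by (rule has_vector_derivative_eq_rhs [OF has_vector_derivative_mult [OF 1 2]])
       (simp add: gkernel_def minus_diff_commute algebra_simps)
  then show ?thesis by (simp add: gkernel_def [abs_def])
qed

lemma gkernel_tendsto_0_right:
  assumes "0 < l" and "0 < Re z"
  shows "(gkernel l p (z + 1) \<longlongrightarrow> 0) (at_right 0)"
proof (rule tendsto_norm_zero_cancel)
  have "((\<lambda>t. (1 + l * t) powr (- p) * t powr Re z) \<longlongrightarrow> (1 + l * 0) powr (- p) * 0 powr Re z) (at_right 0)"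
    using assms by (intro tendsto_intros tendsto_powr') (auto simp: eventually_at_right_less eventually_at_filter)
  then have "((\<lambda>t. (1 + l * t) powr (- p) * t powr Re z) \<longlongrightarrow> 0) (at_right 0)"
    using assms by simp
  moreover have "eventually (\<lambda>t. (1 + l * t) powr (- p) * t powr Re z = norm (gkernel l p (z + 1) t)) (at_right 0)"
    using eventually_at_right_less[of 0] by eventually_elim (simp add: norm_gkernel)
  ultimately show "((\<lambda>t. norm (gkernel l p (z + 1) t)) \<longlongrightarrow> 0) (at_right 0)"
    by (rule Lim_transform_eventually)
qed

lemma gkernel_tendsto_0_at_top:
  assumes "0 < l" and "0 < p" and "Re z < p"
  shows "(gkernel l p (z + 1) \<longlongrightarrow> 0) at_top"
proof (rule Lim_null_comparison)
  show "eventually (\<lambda>t. norm (gkernel l p (z + 1) t) \<le> l powr (- p) * t powr (Re z - p)) at_top"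
    using eventually_gt_at_top[of 0]
    by eventually_elim (use assms norm_gkernel_le_powr[of l p _ "z + 1"] in simp)
  show "((\<lambda>t. l powr (- p) * t powr (Re z - p)) \<longlongrightarrow> 0) at_top"
    using assms by (intro tendsto_mult_right_zero tendsto_neg_powr filterlim_ident) auto
qed

text \<open>
  The kernel at \<open>(p, z + 1)\<close> tends to \<open>0\<close> at both ends, so its derivative integrates to \<open>0\<close>; as both
  terms of the derivative are integrable, their integrals agree.
\<close>
lemma gkernel_integral_by_parts:
  assumes "0 < l" and "0 < Re z" and "Re z < p"
  shows "of_real (l * p) * (LINT t:{0<..}|lborel. gkernel l (p + 1) (z + 1) t) =
           z * (LINT t:{0<..}|lborel. gkernel l p z t)"
proof -
  let ?f = "\<lambda>t. z * gkernel l p z t - of_real (l * p) * gkernel l (p + 1) (z + 1) t"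
  have int: "set_integrable lborel {0<..} (\<lambda>t. z * gkernel l p z t)"
    "set_integrable lborel {0<..} (\<lambda>t. of_real (l * p) * gkernel l (p + 1) (z + 1) t)"
    using assms by (auto intro!: set_integrable_mult_right set_integrable_gkernel)
  have "(LBINT t=ereal 0..\<infinity>. ?f t) = 0 - 0"
  proof (rule interval_integral_FTC_integrable [where F = "gkernel l p (z + 1)"])
    show "(gkernel l p (z + 1) has_vector_derivative ?f t) (at t)" if "ereal 0 < ereal t" for t
      using assms that by (intro gkernel_has_vector_derivative) auto
    show "isCont ?f t" if "ereal 0 < ereal t" for t
      using assms that by (intro continuous_intros isCont_gkernel) auto
    show "set_integrable lborel (einterval (ereal 0) \<infinity>) ?f"
      using set_integral_diff(1)[OF int] by simp
    show "((gkernel l p (z + 1) \<circ> real_of_ereal) \<longlongrightarrow> 0) (at_right (ereal 0))"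
      unfolding ereal_tendsto_simps using assms by (intro gkernel_tendsto_0_right)
    show "((gkernel l p (z + 1) \<circ> real_of_ereal) \<longlongrightarrow> 0) (at_left \<infinity>)"
      unfolding ereal_tendsto_simps using assms by (intro gkernel_tendsto_0_at_top) auto
  qed auto
  then have "(LINT t:{0<..}|lborel. ?f t) = 0"
    by (simp add: interval_integral_to_infinity_eq)
  then show ?thesis
    using set_integral_diff(2)[OF int] by simp
qed

text \<open>
  Substitute \<open>c t\<close> for \<open>t\<close>: the measure contributes one factor \<open>c\<close>, the power of \<open>t\<close> the remaining
  \<open>z - 1\<close>.
\<close>
lemma gkernel_integral_scale:
  assumes "0 < c"
  shows "(LINT t:{0<..}|lborel. gkernel l p z t) =
           of_real c powr z * (LINT t:{0<..}|lborel. gkernel (l * c) p z t)"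
proof -
  have "(LINT t:{0<..}|lborel. gkernel l p z t) =
          c *\<^sub>R (LINT t|lborel. indicat_real {0<..} (c * t) *\<^sub>R gkernel l p z (c * t))"
    using lborel_integral_real_affine[of c "\<lambda>t. indicat_real {0<..} t *\<^sub>R gkernel l p z t" 0] assms
    by (simp add: set_lebesgue_integral_def)
  also have "(\<lambda>t. indicat_real {0<..} (c * t) *\<^sub>R gkernel l p z (c * t)) =
      (\<lambda>t. of_real c powr (z - 1) * (indicat_real {0<..} t *\<^sub>R gkernel (l * c) p z t))"
    using assms
    by (auto simp: fun_eq_iff indicator_def gkernel_def powr_times_real zero_less_mult_iff mult_ac)
  also have "c *\<^sub>R (LINT t|lborel. of_real c powr (z - 1) * (indicat_real {0<..} t *\<^sub>R gkernel (l * c) p z t)) =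
      (of_real c * of_real c powr (z - 1)) * (LINT t:{0<..}|lborel. gkernel (l * c) p z t)"
    by (simp add: set_lebesgue_integral_def scaleR_conv_of_real)
  also have "of_real c * of_real c powr (z - 1) = (of_real c powr z :: complex)"
    using assms by (simp add: powr_diff)
  finally show ?thesis .
qed

theorem theorem2p1:
  fixes l :: real and s :: complex
  assumes "0 < l" and "l < 1"
    and "0 < Re s" and "Re s < (1 - l) / l"
  shows "degenerate_Gamma l (s + 1) =
           s / complex_of_real (1 - l) powr (s + 1) * degenerate_Gamma (l / (1 - l)) s"
proof -
  define c where "c = 1 - l"
  have c: "0 < c" "l * (c / l) = c" "c / l + 1 = 1 / l" "1 / (l / c) = c / l" "l / c * c = l"
    using assms by (auto simp: c_def field_simps)
  have "of_real c * degenerate_Gamma l (s + 1) = s * (LINT t:{0<..}|lborel. gkernel l (c / l) s t)"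
    using gkernel_integral_by_parts[of l s "c / l"] assms(1,3,4) c(2,3)
    by (simp add: degenerate_Gamma_eq c_def)
  moreover have "degenerate_Gamma (l / c) s =
      of_real c powr s * (LINT t:{0<..}|lborel. gkernel l (c / l) s t)"
    unfolding degenerate_Gamma_eq c(4) gkernel_integral_scale[OF c(1), of "l / c"] c(5) ..
  moreover have "complex_of_real c powr (s + 1) = of_real c powr s * of_real c"
    using c(1) by (simp add: powr_add)
  ultimately have "degenerate_Gamma l (s + 1) = s / of_real c powr (s + 1) * degenerate_Gamma (l / c) s"
    using c(1) by (simp add: field_simps)
  then show ?thesis by (simp add: c_def)
qed

end
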